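(* Let $k\ge 3$ and let $\mathcal P_k$ be the path with vertices $1,\dots,k$. Let $1\le i<j\le k$ with $j-i\ge 2$, and let $\mathcal P_k^{\{i,j\}}$ be the graph obtained from $\mathcal P_k$ by adding the edge $\{i,j\}$. If $i\le\lceil k/2\rceil<j$, then $\kappa(\mathcal P_k^{\{i,j\}})-\kappa(\mathcal P_k)<0$.
   Context: For a connected graph $G$, $\kappa(G)$ denotes Kemeny's constant of the simple random walk on $G$: $\kappa(G)=\sum_{j\neq i} m_{ij}\pi_j$, where $m_{ij}$ is the mean first passage time from $i$ to $j$ and $\pi$ is the stationary distribution; this is independent of $i$. *)

theory Defs
  imports "HOL-Probability.Probability"
begin

text \<open>A simple graph is a pair of a vertex set and a set of two-element subsets of it.\<close>

type_synonym 'a ugraph = "'a set \<times> 'a set set"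

abbreviation verts :: "'a ugraph \<Rightarrow> 'a set" where
  "verts G \<equiv> fst G"

abbreviation edges :: "'a ugraph \<Rightarrow> 'a set set" where
  "edges G \<equiv> snd G"

definition neighbours :: "'a ugraph \<Rightarrow> 'a \<Rightarrow> 'a set" where
  "neighbours G u = {v \<in> verts G. {u, v} \<in> edges G}"

definition path_graph :: "nat \<Rightarrow> nat ugraph" where
  "path_graph k = ({1..k}, {{a, Suc a} | a. 1 \<le> a \<and> a < k})"

definition add_edge :: "'a ugraph \<Rightarrow> 'a \<Rightarrow> 'a \<Rightarrow> 'a ugraph" where
  "add_edge G u v = (verts G, insert {u, v} (edges G))"

text \<open>\<^const>\<open>pmf_of_set\<close> is specified only on finite nonempty sets, so \<open>srw_step G u\<close> is
  meaningful only if \<open>u\<close> has a neighbour and only finitely many of them.\<close>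

definition srw_step :: "'a ugraph \<Rightarrow> 'a \<Rightarrow> 'a pmf" where
  "srw_step G u = pmf_of_set (neighbours G u)"

text \<open>\<open>srw_traj G u n\<close> is the joint law of the first \<open>n + 1\<close> positions
  \<open>[X\<^sub>0, \<dots>, X\<^sub>n]\<close> of the simple random walk on \<open>G\<close> started at \<open>X\<^sub>0 = u\<close>.\<close>

primrec srw_traj :: "'a ugraph \<Rightarrow> 'a \<Rightarrow> nat \<Rightarrow> 'a list pmf" where
  "srw_traj G u 0 = return_pmf [u]"
| "srw_traj G u (Suc n) =
     bind_pmf (srw_traj G u n) (\<lambda>xs. map_pmf (\<lambda>x. xs @ [x]) (srw_step G (last xs)))"

text \<open>The probability that the first passage time \<open>T = min {t \<ge> 1. X\<^sub>t = v}\<close> of the walk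
  started at \<open>u\<close> equals \<open>n\<close>.\<close>

definition first_passage_prob :: "'a ugraph \<Rightarrow> 'a \<Rightarrow> 'a \<Rightarrow> nat \<Rightarrow> real" where
  "first_passage_prob G u v n =
     measure_pmf.prob (srw_traj G u n) {xs. 1 \<le> n \<and> xs ! n = v \<and> (\<forall>t\<in>{1..<n}. xs ! t \<noteq> v)}"

text \<open>The expectation of the first passage time. On a finite connected graph with at least two
  vertices that time is almost surely finite and the series converges.\<close>

definition mean_first_passage :: "'a ugraph \<Rightarrow> 'a \<Rightarrow> 'a \<Rightarrow> real" where
  "mean_first_passage G u v = (\<Sum>n. real n * first_passage_prob G u v n)"

definition stationary :: "'a ugraph \<Rightarrow> 'a pmf \<Rightarrow> bool" where
  "stationary G p \<longleftrightarrow> set_pmf p \<subseteq> verts G \<and> bind_pmf p (srw_step G) = p"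

definition stationary_distribution :: "'a ugraph \<Rightarrow> 'a pmf" where
  "stationary_distribution G = (THE p. stationary G p)"

text \<open>Kemeny's constant is the common value of the sums over all starting vertices; for a finite
  connected graph with at least two vertices the sum does not depend on the starting vertex.\<close>

definition kemeny :: "'a ugraph \<Rightarrow> real" where
  "kemeny G = (THE c. \<forall>u\<in>verts G.
     (\<Sum>v\<in>verts G - {u}. mean_first_passage G u v * pmf (stationary_distribution G) v) = c)"

end

theory Submission
  imports Defs
begin

text \<open>Let \<open>R\<close> be the effective resistance of a graph with degrees \<open>d\<close> and let \<open>m\<close> be its number of
  edges. The hitting time of \<open>v\<close> from \<open>u\<close> is \<open>1/2 \<Sum>\<^sub>w d\<^sub>w (R\<^sub>u\<^sub>v + R\<^sub>v\<^sub>w - R\<^sub>u\<^sub>w)\<close>; averaging over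
  \<open>v\<close> with the stationary weights \<open>d\<^sub>v / 2m\<close> cancels the terms in \<open>u\<close>, so that Kemeny's constant is
  \<open>1/(4m) \<Sum>\<^sub>v\<^sub>w d\<^sub>v d\<^sub>w R\<^sub>v\<^sub>w\<close>. Testing the stationarity equation with a hitting time function also
  gives uniqueness of the stationary distribution. On the path \<open>R\<^sub>u\<^sub>v = |u - v|\<close>; the chord subtracts
  \<open>t\<^sup>2 / c\<close>, where \<open>c\<close> is the length of the cycle and \<open>t\<close> the number of path edges between \<open>u\<close> and
  \<open>v\<close> inside it. Both sums have closed forms, and the theorem becomes an inequality between
  polynomials in the lengths of the tails and of the cycle.\<close>

section \<open>First passage times\<close>

definition vdegree :: "'a ugraph \<Rightarrow> 'a \<Rightarrow> real" where
  "vdegree G u = real (card (neighbours G u))"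

lemma neighbours_subset: "neighbours G u \<subseteq> verts G"
  by (auto simp: neighbours_def)

lemma neighbours_commute:
  "u \<in> verts G \<Longrightarrow> v \<in> verts G \<Longrightarrow> u \<in> neighbours G v \<longleftrightarrow> v \<in> neighbours G u"
  by (auto simp: neighbours_def insert_commute)

text \<open>The terms from \<open>n div 2\<close> to \<open>n\<close> are each at least
  \<open>s n\<close>, so \<open>n * s n\<close> is at most twice a difference of partial sums, which
  vanishes in the limit. This removes the boundary term of a later summation by parts.\<close>

lemma decseq_summable_mult_tendsto_0:
  fixes s :: "nat \<Rightarrow> real"
  assumes "decseq s" "\<And>n. s n \<ge> 0" "summable s"
  shows "(\<lambda>n. real n * s n) \<longlonglongrightarrow> 0"
proof -
  define P where "P N = (\<Sum>n<N. s n)" for N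
  have P: "P \<longlonglongrightarrow> suminf s"
    unfolding P_def using assms(3) by (rule summable_LIMSEQ)
  have half: "filterlim (\<lambda>n::nat. n div 2) at_top at_top"
    unfolding filterlim_at_top
  proof
    fix Z :: nat
    show "eventually (\<lambda>n. Z \<le> n div 2) sequentially"
      using eventually_ge_at_top[of "2 * Z"] by eventually_elim auto
  qed
  have bound: "real n * s n \<le> 2 * (P n - P (n div 2))" for n
  proof -
    have "real (n - n div 2) * s n = (\<Sum>m\<in>{n div 2..<n}. s n)" by simp
    also have "\<dots> \<le> (\<Sum>m\<in>{n div 2..<n}. s m)"
      using assms(1) by (intro sum_mono) (auto simp: decseq_def)
    also have "\<dots> = P n - P (n div 2)"
      unfolding P_def lessThan_atLeast0 by (subst sum_diff_nat_ivl) auto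
    finally have "real (n - n div 2) * s n \<le> P n - P (n div 2)" .
    then have "2 * (real (n - n div 2) * s n) \<le> 2 * (P n - P (n div 2))" by simp
    moreover have "real n * s n \<le> (2 * real (n - n div 2)) * s n"
      by (intro mult_right_mono) (use assms(2) in auto)
    ultimately show ?thesis by (metis mult.assoc order.trans)
  qed
  have "(\<lambda>n. 2 * (P n - P (n div 2))) \<longlonglongrightarrow> 2 * (suminf s - suminf s)"
    by (intro tendsto_intros P filterlim_compose[OF P half])
  then have lim: "(\<lambda>n. 2 * (P n - P (n div 2))) \<longlonglongrightarrow> 0" by simp
  show ?thesis
    by (rule tendsto_sandwich[OF _ _ tendsto_const lim]) (use assms(2) bound in auto)
qed

section \<open>Trajectories of the walk on a finite graph\<close>

locale walkable_graph =
  fixes G :: "'a ugraph"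
  assumes finite_verts: "finite (verts G)"
    and neighbours_nonempty: "\<And>u. u \<in> verts G \<Longrightarrow> neighbours G u \<noteq> {}"
begin

abbreviation deg :: "'a \<Rightarrow> real" where
  "deg \<equiv> vdegree G"

lemma finite_neighbours: "finite (neighbours G u)"
  using finite_subset[OF neighbours_subset finite_verts] .

lemma deg_pos: "u \<in> verts G \<Longrightarrow> deg u > 0"
  by (simp add: vdegree_def card_gt_0_iff finite_neighbours neighbours_nonempty)

lemma set_pmf_srw_step: "u \<in> verts G \<Longrightarrow> set_pmf (srw_step G u) = neighbours G u"
  by (simp add: srw_step_def finite_neighbours neighbours_nonempty)

lemma expectation_srw_step:
  fixes g :: "'a \<Rightarrow> real"
  assumes "u \<in> verts G"
  shows "measure_pmf.expectation (srw_step G u) g = (\<Sum>w\<in>neighbours G u. g w) / deg u"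
  using assms
  by (simp add: srw_step_def integral_pmf_of_set finite_neighbours neighbours_nonempty vdegree_def)

lemma pmf_srw_step:
  assumes "u \<in> verts G"
  shows "pmf (srw_step G u) w = (if w \<in> neighbours G u then 1 / deg u else 0)"
  using assms
  by (simp add: srw_step_def finite_neighbours neighbours_nonempty vdegree_def)

lemma expectation_verts:
  fixes g :: "'a \<Rightarrow> real"
  assumes "set_pmf p \<subseteq> verts G"
  shows "measure_pmf.expectation p g = (\<Sum>u\<in>verts G. pmf p u * g u)"
  using assms by (subst integral_measure_pmf[OF finite_verts]) auto

lemma srw_traj_support:
  assumes "u \<in> verts G" "xs \<in> set_pmf (srw_traj G u n)"
  shows "length xs = Suc n \<and> set xs \<subseteq> verts G \<and> xs ! 0 = u"
  using assms(2)
proof (induction n arbitrary: xs)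
  case 0
  then show ?case using assms(1) by simp
next
  case (Suc n)
  then obtain ys x where ys: "ys \<in> set_pmf (srw_traj G u n)"
    and x: "x \<in> set_pmf (srw_step G (last ys))" and xs: "xs = ys @ [x]" by auto
  have IH: "length ys = Suc n" "set ys \<subseteq> verts G" "ys ! 0 = u" using Suc.IH[OF ys] by auto
  then have "ys \<noteq> []" by auto
  then have "last ys \<in> verts G" using IH last_in_set by blast
  then have "x \<in> verts G" using x neighbours_subset[of G "last ys"] by (auto simp: set_pmf_srw_step)
  then show ?case using IH xs by (auto simp: nth_append)
qed

lemma last_srw_traj_in_verts:
  assumes "u \<in> verts G" "xs \<in> set_pmf (srw_traj G u n)"
  shows "last xs \<in> verts G"
proof -
  have "xs \<noteq> []" "set xs \<subseteq> verts G" using srw_traj_support[OF assms] by auto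
  then show ?thesis using last_in_set by blast
qed

lemma finite_srw_traj:
  assumes "u \<in> verts G"
  shows "finite (set_pmf (srw_traj G u n))"
proof (rule finite_subset)
  show "set_pmf (srw_traj G u n) \<subseteq> {xs. set xs \<subseteq> verts G \<and> length xs = Suc n}"
    using srw_traj_support[OF assms] by blast
qed (rule finite_lists_length_eq[OF finite_verts])

lemma expectation_srw_traj:
  fixes F :: "'a list \<Rightarrow> real"
  assumes "u \<in> verts G"
  shows "measure_pmf.expectation (srw_traj G u n) F =
    (\<Sum>xs\<in>set_pmf (srw_traj G u n). pmf (srw_traj G u n) xs * F xs)"
  using integral_measure_pmf[OF finite_srw_traj[OF assms], of "srw_traj G u n" F] by simp

text \<open>Markov property: conditioning on the first \<open>n\<close> steps leaves an average over
  the neighbours of the last position.\<close>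

lemma expectation_srw_traj_Suc:
  fixes F :: "'a list \<Rightarrow> real"
  assumes "u \<in> verts G"
  shows "measure_pmf.expectation (srw_traj G u (Suc n)) F =
    (\<Sum>xs\<in>set_pmf (srw_traj G u n). pmf (srw_traj G u n) xs *
       ((\<Sum>x\<in>neighbours G (last xs). F (xs @ [x])) / deg (last xs)))"
proof -
  note last = last_srw_traj_in_verts[OF assms]
  have "measure_pmf.expectation (srw_traj G u (Suc n)) F =
    (\<Sum>xs\<in>set_pmf (srw_traj G u n). pmf (srw_traj G u n) xs *\<^sub>R
       measure_pmf.expectation (map_pmf (\<lambda>x. xs @ [x]) (srw_step G (last xs))) F)"
    unfolding srw_traj.simps
    by (rule pmf_expectation_bind)
       (auto simp: finite_srw_traj assms set_pmf_srw_step last finite_neighbours)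
  also have "\<dots> = (\<Sum>xs\<in>set_pmf (srw_traj G u n). pmf (srw_traj G u n) xs *
       ((\<Sum>x\<in>neighbours G (last xs). F (xs @ [x])) / deg (last xs)))"
    by (intro sum.cong refl) (simp add: expectation_srw_step last)
  finally show ?thesis .
qed

text \<open>With \<open>E\<^sub>n\<close> the expectation of \<open>h\<close> at time \<open>n\<close> restricted to the event that \<open>v\<close> is not
  yet hit, and \<open>s\<^sub>n\<close> the probability of that event, the hypothesis on \<open>h\<close> gives
  \<open>E\<^sub>n - E\<^sub>n\<^sub>+\<^sub>1 = s\<^sub>n\<close>. Boundedness of \<open>h\<close> makes the series of the \<open>s\<^sub>n\<close> converge, to \<open>h u\<close>.\<close>

lemma mean_first_passage_eqI:
  fixes h :: "'a \<Rightarrow> real"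
  assumes u: "u \<in> verts G" and uv: "u \<noteq> v" and hv: "h v = 0"
    and step: "\<And>w. w \<in> verts G \<Longrightarrow> w \<noteq> v \<Longrightarrow>
      (\<Sum>x\<in>neighbours G w. h x) = deg w * (h w - 1)"
  shows "mean_first_passage G u v = h u"
proof -
  define X where "X n = set_pmf (srw_traj G u n)" for n
  define q where "q n = pmf (srw_traj G u n)" for n
  define A where "A n g = measure_pmf.expectation (srw_traj G u n)
    (\<lambda>xs. if v \<notin> set xs then g (last xs) else (0::real))" for n and g :: "'a \<Rightarrow> real"
  define s where "s n = A n (\<lambda>_. 1)" for n
  define f where "f = first_passage_prob G u v"
  have A_sum: "A n g = (\<Sum>xs\<in>X n. q n xs * (if v \<notin> set xs then g (last xs) else 0))" for n g
    unfolding A_def X_def q_def by (rule expectation_srw_traj[OF u])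
  have last: "last xs \<in> verts G" if "xs \<in> X n" for xs n
    using last_srw_traj_in_verts[OF u] that by (simp add: X_def)
  have last_neq: "last xs \<noteq> v" if "xs \<in> X n" "v \<notin> set xs" for xs n
  proof -
    have "xs \<noteq> []" using srw_traj_support[OF u, of xs n] that(1) by (auto simp: X_def)
    then show ?thesis using that(2) last_in_set by blast
  qed
  \<comment> \<open>The longer trajectory avoids \<open>v\<close> iff its prefix does and the new
    step does not enter \<open>v\<close>.\<close>
  have A_Suc: "A (Suc n) g = (\<Sum>xs\<in>X n. q n xs * (if v \<notin> set xs then
      (\<Sum>x\<in>neighbours G (last xs). if x \<noteq> v then g x else 0) / deg (last xs) else 0))" for n g
    unfolding A_def X_def q_def expectation_srw_traj_Suc[OF u]
    by (intro sum.cong refl arg_cong2[of _ _ _ _ "(*)"]) (auto intro!: sum.cong)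
  have f_Suc: "f (Suc n) = (\<Sum>xs\<in>X n. q n xs * (if v \<notin> set xs then
      (\<Sum>x\<in>neighbours G (last xs). if x = v then 1 else 0) / deg (last xs) else 0))" for n
  proof -
    define B where "B = {xs. xs ! Suc n = v \<and> (\<forall>t\<in>{1..<Suc n}. xs ! t \<noteq> v)}"
    have "f (Suc n) = measure_pmf.expectation (srw_traj G u (Suc n)) (indicator B)"
      by (simp add: f_def first_passage_prob_def B_def)
    also have "\<dots> = (\<Sum>xs\<in>X n. q n xs *
       ((\<Sum>x\<in>neighbours G (last xs). indicator B (xs @ [x])) / deg (last xs)))"
      unfolding X_def q_def by (rule expectation_srw_traj_Suc[OF u])
    also have "\<dots> = (\<Sum>xs\<in>X n. q n xs * (if v \<notin> set xs then
      (\<Sum>x\<in>neighbours G (last xs). if x = v then 1 else 0) / deg (last xs) else 0))"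
    proof (intro sum.cong refl arg_cong2[of _ _ _ _ "(*)"])
      fix xs assume "xs \<in> X n"
      then have xs: "length xs = Suc n" "xs ! 0 = u"
        using srw_traj_support[OF u] by (auto simp: X_def)
      \<comment> \<open>First passage ignores time 0 while \<open>set xs\<close> includes it; the
        two events agree because the walk starts at \<open>u \<noteq> v\<close>.\<close>
      have "v \<in> set xs \<longleftrightarrow> (\<exists>t<Suc n. xs ! t = v)" using xs by (auto simp: in_set_conv_nth)
      also have "\<dots> \<longleftrightarrow> (\<exists>t\<in>{1..<Suc n}. xs ! t = v)"
      proof
        assume "\<exists>t<Suc n. xs ! t = v"
        then obtain t where t: "t < Suc n" "xs ! t = v" by auto
        then have "t \<noteq> 0" using uv xs(2) by (metis)
        then show "\<exists>t\<in>{1..<Suc n}. xs ! t = v" using t by force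
      qed auto
      finally have v: "v \<in> set xs \<longleftrightarrow> (\<exists>t\<in>{1..<Suc n}. xs ! t = v)" .
      have "xs @ [x] \<in> B \<longleftrightarrow> x = v \<and> v \<notin> set xs" for x
        unfolding B_def v using xs(1) by (auto simp: nth_append)
      then show "(\<Sum>x\<in>neighbours G (last xs). indicator B (xs @ [x])) / deg (last xs) =
        (if v \<notin> set xs then (\<Sum>x\<in>neighbours G (last xs). if x = v then 1 else 0) / deg (last xs)
         else 0)"
        by (auto simp: indicator_def intro!: sum.cong)
    qed
    finally show ?thesis .
  qed
  have s_diff: "s n = s (Suc n) + f (Suc n)" for n
  proof -
    have eq: "(\<Sum>x\<in>N. if x \<noteq> v then 1 else 0) / c + (\<Sum>x\<in>N. if x = v then 1 else 0) / c
        = real (card N) / c" for N and c :: real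
    proof -
      have "(\<Sum>x\<in>N. (if x \<noteq> v then 1 else 0) + (if x = v then 1 else 0 :: real)) = (\<Sum>x\<in>N. 1)"
        by (intro sum.cong) auto
      then show ?thesis unfolding add_divide_distrib[symmetric] sum.distrib[symmetric] by simp
    qed
    show ?thesis
      unfolding s_def f_Suc A_Suc A_sum[of n] sum.distrib[symmetric]
    proof (rule sum.cong[OF refl])
      fix xs assume "xs \<in> X n"
      then have "real (card (neighbours G (last xs))) / deg (last xs) = 1"
        using deg_pos[OF last] by (fastforce simp: vdegree_def)
      then show "q n xs * (if v \<notin> set xs then 1 else 0) =
        q n xs * (if v \<notin> set xs then
          (\<Sum>x\<in>neighbours G (last xs). if x \<noteq> v then 1 else 0) / deg (last xs) else 0) +
        q n xs * (if v \<notin> set xs then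
          (\<Sum>x\<in>neighbours G (last xs). if x = v then 1 else 0) / deg (last xs) else 0)"
        using eq[of "neighbours G (last xs)" "deg (last xs)"]
        by (simp add: distrib_left[symmetric])
    qed
  qed
  have f_nonneg: "f n \<ge> 0" for n by (simp add: f_def first_passage_prob_def)
  have s_nonneg: "s n \<ge> 0" for n
    unfolding s_def A_sum by (intro sum_nonneg) (auto simp: q_def)
  have s_dec: "decseq s"
    by (rule decseq_SucI) (use s_diff f_nonneg in \<open>metis le_add_same_cancel1\<close>)
  have A_h: "A (Suc n) h = A n h - s n" for n
    unfolding s_def A_Suc A_sum[of n] sum_subtractf[symmetric]
  proof (rule sum.cong[OF refl])
    fix xs assume xs: "xs \<in> X n"
    show "q n xs * (if v \<notin> set xs then
        (\<Sum>x\<in>neighbours G (last xs). if x \<noteq> v then h x else 0) / deg (last xs) else 0) =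
      q n xs * (if v \<notin> set xs then h (last xs) else 0) - q n xs * (if v \<notin> set xs then 1 else 0)"
    proof (cases "v \<in> set xs")
      case False
      have "(\<Sum>x\<in>neighbours G (last xs). if x \<noteq> v then h x else 0) =
          (\<Sum>x\<in>neighbours G (last xs). h x)"
        using hv by (intro sum.cong) auto
      also have "\<dots> = deg (last xs) * (h (last xs) - 1)"
        by (rule step[OF last[OF xs] last_neq[OF xs False]])
      finally have "(\<Sum>x\<in>neighbours G (last xs). if x \<noteq> v then h x else 0) / deg (last xs) =
          h (last xs) - 1"
        using deg_pos[OF last[OF xs]] by simp
      then show ?thesis using False by (simp add: right_diff_distrib)
    qed simp
  qed
  have s_partial: "(\<Sum>n<N. s n) = h u - A N h" for N
    by (induction N) (use uv in \<open>auto simp: A_h A_def[of 0]\<close>)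
  define M where "M = Max ((\<lambda>w. \<bar>h w\<bar>) ` verts G)"
  have M: "\<bar>h w\<bar> \<le> M" if "w \<in> verts G" for w
    unfolding M_def using that finite_verts by (intro Max_ge) auto
  have A_bound: "\<bar>A n h\<bar> \<le> M * s n" for n
  proof -
    have "\<bar>A n h\<bar> \<le> (\<Sum>xs\<in>X n. \<bar>q n xs * (if v \<notin> set xs then h (last xs) else 0)\<bar>)"
      unfolding A_sum by (rule sum_abs)
    also have "\<dots> \<le> (\<Sum>xs\<in>X n. M * (q n xs * (if v \<notin> set xs then 1 else 0)))"
      by (intro sum_mono)
         (auto simp: abs_mult q_def mult.commute[of M] intro!: mult_left_mono M last)
    also have "\<dots> = M * s n" by (simp add: s_def A_sum sum_distrib_left)
    finally show ?thesis .
  qed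
  have s_sum: "summable s"
  proof (rule summableI_nonneg_bounded[OF s_nonneg])
    fix N
    have "s N \<le> s 0" using s_dec by (simp add: decseq_def)
    moreover have "M \<ge> 0" using M[OF u] by linarith
    ultimately have "M * s N \<le> M * s 0" by (rule mult_left_mono)
    then show "(\<Sum>n<N. s n) \<le> h u + M * s 0"
      using A_bound[of N] s_partial[of N] by linarith
  qed
  have "(\<lambda>n. M * s n) \<longlonglongrightarrow> M * 0"
    by (intro tendsto_intros summable_LIMSEQ_zero s_sum)
  then have "(\<lambda>n. A n h) \<longlonglongrightarrow> 0"
    using A_bound by (intro Lim_null_comparison[of "\<lambda>n. A n h" "\<lambda>n. M * s n"]) auto
  then have lim: "(\<lambda>N. h u - A N h - real N * s N) \<longlonglongrightarrow> h u - 0 - 0"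
    by (intro tendsto_diff tendsto_const
        decseq_summable_mult_tendsto_0 s_dec s_nonneg s_sum)
  have "(\<Sum>n<Suc N. real n * f n) = h u - A N h - real N * s N" for N
  proof -
    \<comment> \<open>Summation by parts, with \<open>f (Suc n) = s n - s (Suc n)\<close>.\<close>
    have "(\<Sum>n<Suc N. real n * f n) = (\<Sum>n<N. s n) - real N * s N"
    proof (induction N)
      case (Suc N)
      then show ?case using s_diff[of N] by (simp add: algebra_simps)
    qed simp
    then show ?thesis by (simp add: s_partial)
  qed
  then have "(\<lambda>n. real n * f n) sums h u"
    using lim unfolding sums_def by (subst filterlim_sequentially_Suc[symmetric]) simp
  then show ?thesis unfolding mean_first_passage_def f_def by (rule sums_unique[symmetric])
qed

end

section \<open>Kemeny's constant from effective resistances\<close>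

text \<open>The abstract properties of the effective resistance that the argument needs: \<open>\<tau>\<close> absorbs the
  part of its Laplacian that does not depend on the second vertex.\<close>

locale resistance_graph = walkable_graph G for G :: "'a ugraph" +
  fixes R :: "'a \<Rightarrow> 'a \<Rightarrow> real" and \<tau> :: "'a \<Rightarrow> real"
  assumes verts_nonempty: "verts G \<noteq> {}"
    and R_commute: "\<And>u v. R u v = R v u"
    and R_self: "\<And>v. R v v = 0"
    and laplacian: "\<And>u v. u \<in> verts G \<Longrightarrow> v \<in> verts G \<Longrightarrow>
      (\<Sum>w\<in>neighbours G u. R u v - R w v) = \<tau> u - (if u = v then 2 else 0)"
begin

definition vol :: real where
  "vol = (\<Sum>u\<in>verts G. deg u)"

text \<open>The resistance formula for hitting times. The target comes first, so that
  \<open>hit v\<close> is a function of the starting vertex.\<close>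

definition hit :: "'a \<Rightarrow> 'a \<Rightarrow> real" where
  "hit v u = (\<Sum>w\<in>verts G. deg w * (R u v + R v w - R u w)) / 2"

lemma vol_pos: "vol > 0"
  unfolding vol_def by (intro sum_pos finite_verts verts_nonempty deg_pos)

lemma hit_self: "hit v v = 0"
  by (simp add: hit_def R_self)

text \<open>In the Laplacian of \<open>hit v\<close> the two occurrences of \<open>\<tau> u\<close>
  cancel and only the point masses survive. Off \<open>v\<close> this is the equation of a hitting
  time; the extra \<open>vol\<close> at \<open>v\<close> is what determines the stationary
  weights.\<close>

lemma sum_neighbours_hit:
  assumes "u \<in> verts G" "v \<in> verts G"
  shows "(\<Sum>x\<in>neighbours G u. hit v x) = deg u * (hit v u - 1) + (if u = v then vol else 0)"
proof -
  have "(\<Sum>x\<in>neighbours G u. hit v u - hit v x) =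
      (\<Sum>x\<in>neighbours G u. \<Sum>w\<in>verts G. deg w * ((R u v - R x v) - (R u w - R x w)) / 2)"
    unfolding hit_def diff_divide_distrib[symmetric] sum_subtractf[symmetric] sum_divide_distrib[symmetric]
    by (simp add: algebra_simps)
  also have "\<dots> = (\<Sum>w\<in>verts G. deg w * ((\<Sum>x\<in>neighbours G u. R u v - R x v) -
      (\<Sum>x\<in>neighbours G u. R u w - R x w)) / 2)"
    by (subst sum.swap)
       (simp add: sum_subtractf[symmetric] sum_distrib_left sum_divide_distrib)
  also have "\<dots> = (\<Sum>w\<in>verts G. (if u = w then deg w else 0) - (if u = v then deg w else 0))"
    by (intro sum.cong refl) (simp add: laplacian assms field_simps)
  also have "\<dots> = deg u - (if u = v then vol else 0)"
    using assms by (simp add: sum_subtractf finite_verts vol_def)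
  finally show ?thesis
    by (simp add: sum_subtractf vdegree_def algebra_simps)
qed

lemma mean_first_passage_eq_hit:
  assumes "u \<in> verts G" "v \<in> verts G" "u \<noteq> v"
  shows "mean_first_passage G u v = hit v u"
  by (rule mean_first_passage_eqI)
     (use assms in \<open>auto simp: hit_self sum_neighbours_hit\<close>)

text \<open>Stationarity preserves the expectation of \<open>hit v\<close>. One step changes it by
  \<open>- 1 + pmf p v * vol / deg v\<close>, which must therefore be 0.\<close>

lemma pmf_stationary:
  assumes "stationary G p" "v \<in> verts G"
  shows "pmf p v = deg v / vol"
proof -
  have supp: "set_pmf p \<subseteq> verts G" and inv: "bind_pmf p (srw_step G) = p"
    using assms(1) by (auto simp: stationary_def)
  have total: "(\<Sum>u\<in>verts G. pmf p u) = 1"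
    using sum_pmf_eq_1[OF finite_verts supp] .
  have "(\<Sum>u\<in>verts G. pmf p u * hit v u) = measure_pmf.expectation p (hit v)"
    by (rule expectation_verts[OF supp, symmetric])
  also have "\<dots> = measure_pmf.expectation (bind_pmf p (srw_step G)) (hit v)"
    by (simp add: inv)
  also have "\<dots> = (\<Sum>u\<in>verts G. pmf p u *\<^sub>R measure_pmf.expectation (srw_step G u) (hit v))"
    by (rule pmf_expectation_bind)
       (use supp in \<open>auto simp: finite_verts set_pmf_srw_step finite_neighbours\<close>)
  also have "\<dots> = (\<Sum>u\<in>verts G. pmf p u * hit v u - pmf p u +
      (if u = v then pmf p v * vol / deg v else 0))"
  proof (intro sum.cong refl)
    fix u assume u: "u \<in> verts G"
    then have step: "measure_pmf.expectation (srw_step G u) (hit v) =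
        hit v u - 1 + (if u = v then vol / deg v else 0)"
      using deg_pos[OF u] assms(2)
      by (simp add: expectation_srw_step sum_neighbours_hit add_divide_distrib)
    show "pmf p u *\<^sub>R measure_pmf.expectation (srw_step G u) (hit v) =
      pmf p u * hit v u - pmf p u + (if u = v then pmf p v * vol / deg v else 0)"
      unfolding step by (simp add: algebra_simps)
  qed
  also have "\<dots> = (\<Sum>u\<in>verts G. pmf p u * hit v u) - 1 + pmf p v * vol / deg v"
    using assms(2) by (simp add: sum.distrib sum_subtractf total finite_verts)
  finally show ?thesis using vol_pos deg_pos[OF assms(2)] by (simp add: field_simps)
qed

text \<open>Weights proportional to degrees are invariant: each neighbour of \<open>x\<close> passes
  on mass \<open>1 / vol\<close>, and adjacency is symmetric.\<close>

lemma ex_stationary: "\<exists>p. stationary G p"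
proof -
  define f where "f u = (if u \<in> verts G then deg u / vol else 0)" for u
  have f_nonneg: "f u \<ge> 0" for u
    using vol_pos by (simp add: f_def vdegree_def)
  have "(\<integral>\<^sup>+ u. ennreal (f u) \<partial>count_space UNIV) = (\<Sum>u\<in>verts G. ennreal (f u))"
    by (rule nn_integral_count_space') (auto simp: finite_verts f_def)
  also have "\<dots> = ennreal (\<Sum>u\<in>verts G. f u)"
    by (rule sum_ennreal) (rule f_nonneg)
  also have "(\<Sum>u\<in>verts G. f u) = 1"
    using vol_pos by (simp add: f_def vol_def sum_divide_distrib[symmetric])
  finally have pmf_f: "pmf (embed_pmf f) u = f u" for u
    by (intro pmf_embed_pmf f_nonneg) simp
  have supp: "set_pmf (embed_pmf f) \<subseteq> verts G"
    by (auto simp: set_pmf_iff pmf_f f_def split: if_splits)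
  have "bind_pmf (embed_pmf f) (srw_step G) = embed_pmf f"
  proof (rule pmf_eqI)
    fix x
    have "pmf (bind_pmf (embed_pmf f) (srw_step G)) x =
        (\<Sum>u\<in>verts G. pmf (embed_pmf f) u * pmf (srw_step G u) x)"
      unfolding pmf_bind by (rule expectation_verts[OF supp])
    also have "\<dots> = (\<Sum>u\<in>verts G. if x \<in> neighbours G u then 1 / vol else 0)"
      using deg_pos by (intro sum.cong refl) (force simp: pmf_f f_def pmf_srw_step)
    also have "\<dots> = real (card {u \<in> verts G. x \<in> neighbours G u}) / vol"
      by (simp add: sum.inter_filter[symmetric] finite_verts)
    also have "\<dots> = f x"
    proof (cases "x \<in> verts G")
      case True
      then have "{u \<in> verts G. x \<in> neighbours G u} = neighbours G x"
        using neighbours_commute[of _ G x] neighbours_subset[of G x] by auto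
      then show ?thesis using True by (simp add: f_def vdegree_def)
    next
      case False
      then have empty: "{u \<in> verts G. x \<in> neighbours G u} = {}"
        by (auto simp: neighbours_def)
      show ?thesis unfolding empty using False by (simp add: f_def)
    qed
    finally show "pmf (bind_pmf (embed_pmf f) (srw_step G)) x = pmf (embed_pmf f) x"
      by (simp add: pmf_f)
  qed
  then show ?thesis using supp unfolding stationary_def by blast
qed

lemma pmf_stationary_distribution:
  assumes "v \<in> verts G"
  shows "pmf (stationary_distribution G) v = deg v / vol"
proof -
  obtain p where p: "stationary G p" using ex_stationary by blast
  have "p' = p" if p': "stationary G p'" for p'
  proof (rule pmf_eqI)
    fix x
    show "pmf p' x = pmf p x"
    proof (cases "x \<in> verts G")
      case True
      then show ?thesis using p p' by (simp add: pmf_stationary)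
    next
      case False
      then have "x \<notin> set_pmf p" "x \<notin> set_pmf p'"
        using p p' by (auto simp: stationary_def)
      then show ?thesis by (simp add: set_pmf_iff)
    qed
  qed
  with p have "stationary G (stationary_distribution G)"
    unfolding stationary_distribution_def by (rule theI)
  then show ?thesis using assms by (rule pmf_stationary)
qed

text \<open>The weighted sum of hitting times does not depend on the start \<open>u\<close>, so the
  \<open>THE\<close> in \<open>kemeny\<close> has a unique candidate.\<close>

theorem kemeny_eq_resistance_sum:
  "kemeny G = (\<Sum>v\<in>verts G. deg v * (\<Sum>w\<in>verts G. deg w * R v w)) / (2 * vol)"
proof -
  define K where "K = (\<Sum>v\<in>verts G. deg v * (\<Sum>w\<in>verts G. deg w * R v w)) / (2 * vol)"
  have K: "(\<Sum>v\<in>verts G - {u}. mean_first_passage G u v * pmf (stationary_distribution G) v) = K"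
    if u: "u \<in> verts G" for u
  proof -
    \<comment> \<open>This is the contribution of \<open>u\<close>; it enters once through
      \<open>R u v\<close> and once through \<open>- R u w\<close>, and cancels.\<close>
    define r where "r = (\<Sum>w\<in>verts G. deg w * R u w)"
    have "(\<Sum>v\<in>verts G - {u}. mean_first_passage G u v * pmf (stationary_distribution G) v) =
        (\<Sum>v\<in>verts G - {u}. hit v u * (deg v / vol))"
      using u by (intro sum.cong refl)
        (auto simp: mean_first_passage_eq_hit pmf_stationary_distribution)
    also have "\<dots> = (\<Sum>v\<in>verts G. hit v u * (deg v / vol))"
      using u by (simp add: sum.remove[OF finite_verts] hit_self)
    also have "\<dots> = (\<Sum>v\<in>verts G. (deg v * R u v * vol + deg v * (\<Sum>w\<in>verts G. deg w * R v w)
        - deg v * r) / (2 * vol))"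
    proof (intro sum.cong refl)
      fix v
      have hit: "hit v u = (R u v * vol + (\<Sum>w\<in>verts G. deg w * R v w) - r) / 2"
        by (simp add: hit_def vol_def r_def distrib_left right_diff_distrib sum.distrib
            sum_subtractf sum_distrib_left mult.commute)
      show "hit v u * (deg v / vol) = (deg v * R u v * vol +
          deg v * (\<Sum>w\<in>verts G. deg w * R v w) - deg v * r) / (2 * vol)"
        unfolding hit using vol_pos by (simp add: field_simps)
    qed
    also have "\<dots> = (r * vol + (\<Sum>v\<in>verts G. deg v * (\<Sum>w\<in>verts G. deg w * R v w)) - vol * r)
        / (2 * vol)"
      by (simp add: sum_divide_distrib[symmetric] sum.distrib sum_subtractf
          sum_distrib_right[symmetric] r_def[symmetric] vol_def[symmetric])
    finally show ?thesis by (simp add: K_def)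
  qed
  have "kemeny G = K"
    unfolding kemeny_def
  proof (rule the_equality)
    fix c
    assume "\<forall>u\<in>verts G. (\<Sum>v\<in>verts G - {u}.
      mean_first_passage G u v * pmf (stationary_distribution G) v) = c"
    then show "c = K" using K verts_nonempty by auto
  qed (simp add: K)
  then show ?thesis by (simp add: K_def)
qed

end

section \<open>The path and the path with a chord\<close>

text \<open>Degree-weighted vertex sums are regrouped by path edges, because in this form they
  telescope.\<close>

abbreviation edge_sum :: "nat \<Rightarrow> (nat \<Rightarrow> real) \<Rightarrow> real" where
  "edge_sum k f \<equiv> \<Sum>a\<in>{1..<k}. f a + f (Suc a)"

text \<open>The closed forms below are obtained by exhibiting a discrete antiderivative
  \<open>F\<close>.\<close>

lemma edge_sum_telescope:
  assumes "\<And>a. 1 \<le> a \<Longrightarrow> a < k \<Longrightarrow> f a + f (Suc a) = F (Suc a) - F a" and "1 \<le> k"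
  shows "edge_sum k f = F k - F 1"
proof -
  have "edge_sum k f = (\<Sum>a\<in>{1..<k}. F (Suc a) - F a)"
    using assms(1) by (intro sum.cong) auto
  also have "\<dots> = F k - F 1" using assms(2) by (rule sum_Suc_diff')
  finally show ?thesis .
qed

section \<open>Neighbour sums in the path and after adding an edge\<close>

lemma verts_path_graph [simp]: "verts (path_graph k) = {1..k}"
  by (simp add: path_graph_def)

lemma verts_add_edge [simp]: "verts (add_edge G u v) = verts G"
  by (simp add: add_edge_def)

lemma neighbours_path_graph:
  assumes "u \<in> {1..k}"
  shows "neighbours (path_graph k) u =
    (if 1 < u then {u - 1} else {}) \<union> (if u < k then {Suc u} else {})"
proof -
  have edge: "{u, v} \<in> edges (path_graph k) \<longleftrightarrow> 1 \<le> u \<and> u < k \<and> v = Suc u \<or> 1 \<le> v \<and> v < k \<and> u = Suc v" for v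
    by (auto simp: path_graph_def doubleton_eq_iff)
  show ?thesis
    unfolding neighbours_def edge using assms by auto
qed

lemma sum_neighbours_path_graph:
  fixes f :: "nat \<Rightarrow> real"
  assumes "u \<in> {1..k}"
  shows "(\<Sum>w\<in>neighbours (path_graph k) u. f w) =
    (if 1 < u then f (u - 1) else 0) + (if u < k then f (Suc u) else 0)"
  by (simp add: neighbours_path_graph[OF assms])

lemma vdegree_eq_sum: "vdegree G u = (\<Sum>w\<in>neighbours G u. 1)"
  by (simp add: vdegree_def)

lemma vdegree_path_graph:
  assumes "u \<in> {1..k}"
  shows "vdegree (path_graph k) u = (if 1 < u then 1 else 0) + (if u < k then 1 else 0)"
  unfolding vdegree_eq_sum by (rule sum_neighbours_path_graph[OF assms])

lemma sum_vdegree_path_graph: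
  fixes f :: "nat \<Rightarrow> real"
  shows "(\<Sum>v\<in>{1..k}. vdegree (path_graph k) v * f v) = edge_sum k f"
proof -
  have "(\<Sum>v\<in>{1..k}. vdegree (path_graph k) v * f v) =
      (\<Sum>v\<in>{1..k}. if v < k then f v else 0) + (\<Sum>v\<in>{1..k}. if 1 < v then f v else 0)"
    unfolding sum.distrib[symmetric]
    by (intro sum.cong refl) (simp add: vdegree_path_graph)
  also have "(\<Sum>v\<in>{1..k}. if v < k then f v else 0) = (\<Sum>v\<in>{1..<k}. f v)"
    by (intro sum.mono_neutral_cong_right) auto
  also have "(\<Sum>v\<in>{1..k}. if 1 < v then f v else 0) = (\<Sum>v\<in>{Suc 1..<Suc k}. f v)"
    by (intro sum.mono_neutral_cong_right) auto
  also have "\<dots> = (\<Sum>v\<in>{1..<k}. f (Suc v))"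
    by (rule sum.shift_bounds_Suc_ivl)
  finally show ?thesis by (simp add: sum.distrib)
qed

lemma neighbours_add_edge:
  assumes "u \<in> verts G" "i \<in> verts G" "j \<in> verts G"
  shows "neighbours (add_edge G i j) u =
    neighbours G u \<union> (if u = i then {j} else {}) \<union> (if u = j then {i} else {})"
  using assms by (auto simp: neighbours_def add_edge_def doubleton_eq_iff)

text \<open>Distinct, nonadjacent endpoints make the new neighbours disjoint from the old ones, so
  the sums add.\<close>

lemma sum_neighbours_add_edge:
  fixes f :: "'a \<Rightarrow> real"
  assumes "finite (verts G)" "u \<in> verts G" "i \<in> verts G" "j \<in> verts G" "i \<noteq> j"
    and "j \<notin> neighbours G i"
  shows "(\<Sum>w\<in>neighbours (add_edge G i j) u. f w) =
    (\<Sum>w\<in>neighbours G u. f w) + (if u = i then f j else 0) + (if u = j then f i else 0)"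
proof -
  have "finite (neighbours G x)" for x
    using finite_subset[OF neighbours_subset assms(1)] .
  moreover have "i \<notin> neighbours G j"
    using assms by (simp add: neighbours_commute)
  ultimately show ?thesis using assms by (simp add: neighbours_add_edge)
qed

section \<open>Kemeny's constant of the path\<close>

lemma edge_sum_abs:
  assumes "x \<in> {1..k}"
  shows "edge_sum k (\<lambda>a. \<bar>real x - real a\<bar>) = (real x - 1)\<^sup>2 + (real k - real x)\<^sup>2"
proof -
  \<comment> \<open>The signed square of the distance to \<open>x\<close>; as \<open>x\<close> is a
    vertex, the sign does not change within an edge.\<close>
  define F where "F a = (real a - real x) * \<bar>real a - real x\<bar>" for a
  have "edge_sum k (\<lambda>a. \<bar>real x - real a\<bar>) = F k - F 1"
  proof (rule edge_sum_telescope)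
    fix a
    show "\<bar>real x - real a\<bar> + \<bar>real x - real (Suc a)\<bar> = F (Suc a) - F a"
    proof (cases "x \<le> a")
      case True
      then show ?thesis by (simp add: F_def algebra_simps)
    next
      case False
      then have "\<bar>real a - real x\<bar> = real x - real a"
        "\<bar>real (Suc a) - real x\<bar> = real x - real (Suc a)" by auto
      then show ?thesis unfolding F_def abs_minus_commute[of "real x"] by (simp add: algebra_simps)
    qed
  qed (use assms in auto)
  also have "\<dots> = (real x - 1)\<^sup>2 + (real k - real x)\<^sup>2"
    using assms by (auto simp: F_def abs_if power2_eq_square algebra_simps)
  finally show ?thesis .
qed

lemma edge_sum_squares:
  assumes "k \<ge> 1"
  shows "edge_sum k (\<lambda>x. (real x - 1)\<^sup>2 + (real k - real x)\<^sup>2) =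
    2 * (real k - 1) * (2 * (real k - 1)\<^sup>2 + 1) / 3"
proof -
  \<comment> \<open>The increment of \<open>(2 * y ^ 3 + y) / 3\<close> from \<open>y\<close> to
    \<open>y + 1\<close> is \<open>y\<^sup>2 + (y + 1)\<^sup>2\<close>; the second half is the
    mirror image.\<close>
  define F where "F a = (2 * (real a - 1) ^ 3 + (real a - 1)) / 3
    - (2 * (real k - real a) ^ 3 + (real k - real a)) / 3" for a
  have "edge_sum k (\<lambda>x. (real x - 1)\<^sup>2 + (real k - real x)\<^sup>2) = F k - F 1"
    by (rule edge_sum_telescope)
       (use assms in \<open>auto simp: F_def field_simps power2_eq_square power3_eq_cube\<close>)
  also have "\<dots> = 2 * (real k - 1) * (2 * (real k - 1)\<^sup>2 + 1) / 3"
    by (simp add: F_def field_simps power2_eq_square power3_eq_cube)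
  finally show ?thesis .
qed

text \<open>The second difference of the distance to \<open>v\<close> vanishes away from
  \<open>v\<close>; the missing neighbour at each end of the path contributes the 1.\<close>

lemma laplacian_path_graph:
  assumes "k \<ge> 2" "u \<in> {1..k}" "v \<in> {1..k}"
  shows "(\<Sum>w\<in>neighbours (path_graph k) u. \<bar>real u - real v\<bar> - \<bar>real w - real v\<bar>) =
    (if u = 1 then 1 else 0) + (if u = k then 1 else 0) - (if u = v then 2 else 0)"
  unfolding sum_neighbours_path_graph[OF assms(2)]
  using assms by (auto simp: abs_if of_nat_diff)

lemma resistance_path_graph:
  assumes "k \<ge> 2"
  shows "resistance_graph (path_graph k) (\<lambda>u v. \<bar>real u - real v\<bar>)
    (\<lambda>u. (if u = 1 then 1 else 0) + (if u = k then 1 else 0))"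
proof
  fix u assume "u \<in> verts (path_graph k)"
  then show "neighbours (path_graph k) u \<noteq> {}"
    using assms by (auto simp: neighbours_path_graph)
qed (use assms in \<open>auto simp: laplacian_path_graph[OF assms]\<close>)

lemma kemeny_path_graph:
  assumes "k \<ge> 2"
  shows "kemeny (path_graph k) = (2 * (real k - 1)\<^sup>2 + 1) / 6"
proof -
  interpret resistance_graph "path_graph k" "\<lambda>u v. \<bar>real u - real v\<bar>"
    "\<lambda>u. (if u = 1 then 1 else 0) + (if u = k then 1 else 0)"
    by (rule resistance_path_graph[OF assms])
  have "vol = (\<Sum>v\<in>{1..k}. deg v * 1)" by (simp add: vol_def)
  also have "\<dots> = 2 * (real k - 1)"
    unfolding sum_vdegree_path_graph using assms by (simp add: of_nat_diff)
  finally have vol: "vol = 2 * (real k - 1)" .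
  have "(\<Sum>v\<in>{1..k}. deg v * (\<Sum>w\<in>{1..k}. deg w * \<bar>real v - real w\<bar>)) =
      (\<Sum>v\<in>{1..k}. deg v * ((real v - 1)\<^sup>2 + (real k - real v)\<^sup>2))"
    by (intro sum.cong refl) (simp only: sum_vdegree_path_graph edge_sum_abs)
  also have "\<dots> = 2 * (real k - 1) * (2 * (real k - 1)\<^sup>2 + 1) / 3"
    unfolding sum_vdegree_path_graph using assms by (intro edge_sum_squares) simp
  finally have sum: "(\<Sum>v\<in>{1..k}. deg v * (\<Sum>w\<in>{1..k}. deg w * \<bar>real v - real w\<bar>)) = \<dots>" .
  show ?thesis
    unfolding kemeny_eq_resistance_sum vol verts_path_graph sum using assms by (simp add: field_simps)
qed

section \<open>Effective resistance of the path with a chord\<close>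

text \<open>The nearest cycle vertex: a point of a tail is sent to the vertex where that tail is
  attached.\<close>

definition cyc_proj :: "nat \<Rightarrow> nat \<Rightarrow> nat \<Rightarrow> real" where
  "cyc_proj i j u = real (min (max u i) j)"

text \<open>Two points of a cycle of length \<open>c\<close> at distance \<open>t\<close> have effective resistance
  \<open>t * (c - t) / c = t - t\<^sup>2 / c\<close>, and the tail edges contribute their length.\<close>

definition chord_resistance :: "nat \<Rightarrow> nat \<Rightarrow> nat \<Rightarrow> nat \<Rightarrow> real" where
  "chord_resistance i j u v = \<bar>real u - real v\<bar>
     - (cyc_proj i j u - cyc_proj i j v)\<^sup>2 / (real j - real i + 1)"

text \<open>The path value plus a correction on the cycle, whose length is the denominator.\<close>

definition chord_tau :: "nat \<Rightarrow> nat \<Rightarrow> nat \<Rightarrow> nat \<Rightarrow> real" where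
  "chord_tau k i j u = (if u = 1 then 1 else 0) + (if u = k then 1 else 0)
     + (if i < u \<and> u < j then 2 else if u = i \<or> u = j then 1 - (real j - real i) else 0)
       / (real j - real i + 1)"

locale chorded_path =
  fixes k i j :: nat
  assumes i1: "1 \<le> i" and ij: "i + 2 \<le> j" and jk: "j \<le> k"
begin

abbreviation H :: "nat ugraph" where
  "H \<equiv> add_edge (path_graph k) i j"

lemma sum_neighbours_H:
  fixes f :: "nat \<Rightarrow> real"
  assumes "u \<in> {1..k}"
  shows "(\<Sum>w\<in>neighbours H u. f w) = (\<Sum>w\<in>neighbours (path_graph k) u. f w)
    + (if u = i then f j else 0) + (if u = j then f i else 0)"
proof (rule sum_neighbours_add_edge)
  show "j \<notin> neighbours (path_graph k) i"
    using i1 ij jk by (auto simp: neighbours_path_graph)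
qed (use i1 ij jk assms in auto)

lemma vdegree_H:
  assumes "u \<in> {1..k}"
  shows "vdegree H u = vdegree (path_graph k) u + (if u = i then 1 else 0) + (if u = j then 1 else 0)"
  unfolding vdegree_eq_sum by (rule sum_neighbours_H[OF assms])

lemma sum_vdegree_H:
  fixes f :: "nat \<Rightarrow> real"
  shows "(\<Sum>v\<in>{1..k}. vdegree H v * f v) = edge_sum k f + f i + f j"
proof -
  have "(\<Sum>v\<in>{1..k}. vdegree H v * f v) = (\<Sum>v\<in>{1..k}. vdegree (path_graph k) v * f v
      + (if v = i then f i else 0) + (if v = j then f j else 0))"
    by (intro sum.cong refl) (simp add: vdegree_H distrib_right)
  also have "\<dots> = edge_sum k f + f i + f j"
    unfolding sum.distrib sum_vdegree_path_graph using i1 ij jk by (simp add: sum.distrib)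
  finally show ?thesis .
qed

lemma cyc_proj_simps:
  "u \<le> i \<Longrightarrow> cyc_proj i j u = real i"
  "i \<le> u \<Longrightarrow> u \<le> j \<Longrightarrow> cyc_proj i j u = real u"
  "j \<le> u \<Longrightarrow> cyc_proj i j u = real j"
  using ij by (auto simp: cyc_proj_def)

lemma cyc_proj_ends [simp]: "cyc_proj i j i = real i" "cyc_proj i j j = real j"
  using ij by (auto simp: cyc_proj_def)

text \<open>A square has constant second difference inside the cycle. At \<open>i\<close> and
  \<open>j\<close> only the inward neighbour counts, as the projection is constant along the
  tails.\<close>

lemma laplacian_cyc_proj_square:
  assumes "u \<in> {1..k}"
  shows "(\<Sum>w\<in>neighbours (path_graph k) u. (cyc_proj i j u - P)\<^sup>2 - (cyc_proj i j w - P)\<^sup>2) =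
    (if i < u \<and> u < j then -2 else if u = i then 2 * (P - real i) - 1
     else if u = j then 2 * (real j - P) - 1 else 0)"
proof -
  consider "u < i" | "u = i" | "i < u" "u < j" | "u = j" | "j < u" by linarith
  then show ?thesis
    unfolding sum_neighbours_path_graph[OF assms]
    by cases (use i1 ij jk in
      \<open>auto simp: cyc_proj_simps of_nat_diff power2_eq_square algebra_simps\<close>)
qed

lemma abs_diff_ends: "\<bar>real i - real v\<bar> - \<bar>real j - real v\<bar> = 2 * cyc_proj i j v - real i - real j"
  using ij by (auto simp: cyc_proj_def min_def max_def abs_if)

text \<open>This is the term that the chord itself adds to the Laplacian at \<open>i\<close>, and
  with opposite sign at \<open>j\<close>.\<close>

lemma chord_resistance_ends:
  "chord_resistance i j i v - chord_resistance i j j v =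
    (2 * cyc_proj i j v - real i - real j) / (real j - real i + 1)"
proof -
  define c P where "c = real j - real i + 1" and "P = cyc_proj i j v"
  have c: "c > 0" using ij by (simp add: c_def)
  have "chord_resistance i j i v - chord_resistance i j j v =
      (2 * P - real i - real j) - ((real i - P)\<^sup>2 - (real j - P)\<^sup>2) / c"
    using abs_diff_ends[of v]
    by (simp add: chord_resistance_def P_def c_def diff_divide_distrib)
  also have "(real i - P)\<^sup>2 - (real j - P)\<^sup>2 = (2 * P - real i - real j) * (c - 1)"
    by (simp add: c_def power2_eq_square algebra_simps)
  also have "(2 * P - real i - real j) - (2 * P - real i - real j) * (c - 1) / c =
      (2 * P - real i - real j) / c"
    using c by (simp add: field_simps)
  finally show ?thesis by (simp add: P_def c_def)
qed

text \<open>At \<open>i\<close> and \<open>j\<close> the dependence on the projection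
  \<open>P\<close> of \<open>v\<close> cancels between the chord term and the square, so
  \<open>chord_tau\<close> need not mention \<open>v\<close>.\<close>

lemma laplacian_H:
  assumes u: "u \<in> {1..k}" and v: "v \<in> {1..k}"
  shows "(\<Sum>w\<in>neighbours H u. chord_resistance i j u v - chord_resistance i j w v) =
    chord_tau k i j u - (if u = v then 2 else 0)"
proof -
  define c P where "c = real j - real i + 1" and "P = cyc_proj i j v"
  have c: "c > 0" using ij by (simp add: c_def)
  have "(\<Sum>w\<in>neighbours (path_graph k) u. chord_resistance i j u v - chord_resistance i j w v) =
    (\<Sum>w\<in>neighbours (path_graph k) u. \<bar>real u - real v\<bar> - \<bar>real w - real v\<bar>) -
    (\<Sum>w\<in>neighbours (path_graph k) u. (cyc_proj i j u - P)\<^sup>2 - (cyc_proj i j w - P)\<^sup>2) / c"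
    unfolding sum_divide_distrib sum_subtractf[symmetric]
    by (intro sum.cong refl) (simp add: chord_resistance_def P_def c_def diff_divide_distrib)
  also have "\<dots> = (if u = 1 then 1 else 0) + (if u = k then 1 else 0) - (if u = v then 2 else 0)
    - (if i < u \<and> u < j then -2 else if u = i then 2 * (P - real i) - 1
       else if u = j then 2 * (real j - P) - 1 else 0) / c"
    using i1 ij jk by (simp only: laplacian_path_graph[OF _ u v] laplacian_cyc_proj_square[OF u])
  finally have path: "(\<Sum>w\<in>neighbours (path_graph k) u.
    chord_resistance i j u v - chord_resistance i j w v) = \<dots>" .
  have ends: "chord_resistance i j i v - chord_resistance i j j v = (2 * P - real i - real j) / c"
    unfolding P_def c_def by (rule chord_resistance_ends)
  then have ends': "chord_resistance i j j v - chord_resistance i j i v =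
      - ((2 * P - real i - real j) / c)"
    by linarith
  show ?thesis
    unfolding sum_neighbours_H[OF u] path chord_tau_def c_def[symmetric]
    using ends ends' ij c by (auto simp: field_simps c_def)
qed

lemma resistance_H: "resistance_graph H (chord_resistance i j) (chord_tau k i j)"
proof
  fix u assume "u \<in> verts H"
  then show "neighbours H u \<noteq> {}"
    using i1 ij jk by (auto simp: neighbours_add_edge neighbours_path_graph)
next
  fix u v
  show "chord_resistance i j u v = chord_resistance i j v u"
    by (simp add: chord_resistance_def abs_minus_commute power2_commute)
  show "chord_resistance i j v v = 0"
    by (simp add: chord_resistance_def)
qed (use i1 ij jk in \<open>auto simp: laplacian_H\<close>)

section \<open>Degree-weighted sums for the path with a chord\<close>

lemma sum_vdegree_cyc_proj:
  "(\<Sum>v\<in>{1..k}. vdegree H v * (cyc_proj i j v - real i)) =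
    (real j - real i) * (real j - real i + 1 + 2 * (real k - real j))"
proof -
  \<comment> \<open>Zero on the left tail, quadratic on the cycle and linear on the right tail,
    where the projection stays at \<open>j\<close>.\<close>
  define F where "F a = (cyc_proj i j a - real i)\<^sup>2
    + 2 * (real j - real i) * (real (max a j) - real j)" for a
  have "edge_sum k (\<lambda>a. cyc_proj i j a - real i) = F k - F 1"
  proof (rule edge_sum_telescope)
    fix a
    consider "a < i" | "i \<le> a" "a < j" | "j \<le> a" by linarith
    then show "cyc_proj i j a - real i + (cyc_proj i j (Suc a) - real i) = F (Suc a) - F a"
      by cases (use ij in
        \<open>auto simp: F_def cyc_proj_def min_def max_def power2_eq_square algebra_simps\<close>)
  qed (use i1 ij jk in auto)
  also have "\<dots> = (real j - real i)\<^sup>2 + 2 * (real j - real i) * (real k - real j)"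
    using i1 ij jk by (auto simp: F_def cyc_proj_def min_def max_def)
  finally show ?thesis
    unfolding sum_vdegree_H by (simp add: power2_eq_square algebra_simps)
qed

lemma sum_vdegree_cyc_proj_square:
  "(\<Sum>v\<in>{1..k}. vdegree H v * (cyc_proj i j v - real i)\<^sup>2) =
    (2 * (real j - real i) ^ 3 + (real j - real i)) / 3 + (real j - real i)\<^sup>2
    + 2 * (real j - real i)\<^sup>2 * (real k - real j)"
proof -
  \<comment> \<open>The cubic antiderivative of squares on the cycle, continued linearly along the
    right tail.\<close>
  define F where "F a = (2 * (cyc_proj i j a - real i) ^ 3 + (cyc_proj i j a - real i)) / 3
    + 2 * (real j - real i)\<^sup>2 * (real (max a j) - real j)" for a
  have "edge_sum k (\<lambda>a. (cyc_proj i j a - real i)\<^sup>2) = F k - F 1"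
  proof (rule edge_sum_telescope)
    fix a
    consider "a < i" | "i \<le> a" "a < j" | "j \<le> a" by linarith
    then show "(cyc_proj i j a - real i)\<^sup>2 + (cyc_proj i j (Suc a) - real i)\<^sup>2 = F (Suc a) - F a"
      by cases (use ij in
        \<open>auto simp: F_def cyc_proj_def min_def max_def power2_eq_square power3_eq_cube field_simps\<close>)
  qed (use i1 ij jk in auto)
  also have "\<dots> = (2 * (real j - real i) ^ 3 + (real j - real i)) / 3
      + 2 * (real j - real i)\<^sup>2 * (real k - real j)"
    using i1 ij jk by (auto simp: F_def cyc_proj_def min_def max_def)
  finally show ?thesis
    unfolding sum_vdegree_H by simp
qed

lemma sum_vdegree_one: "(\<Sum>v\<in>{1..k}. vdegree H v) = 2 * real k"
  using sum_vdegree_H[of "\<lambda>_. 1"] i1 ij jk by (simp add: of_nat_diff)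

lemma sum_vdegree_abs:
  assumes "x \<in> {1..k}"
  shows "(\<Sum>w\<in>{1..k}. vdegree H w * \<bar>real x - real w\<bar>) =
    (real x - 1)\<^sup>2 + (real k - real x)\<^sup>2 + \<bar>real x - real i\<bar> + \<bar>real x - real j\<bar>"
  unfolding sum_vdegree_H edge_sum_abs[OF assms] ..

text \<open>The chord adds the distances to \<open>i\<close> and \<open>j\<close> to each inner sum;
  by symmetry their outer sums are again instances of \<open>sum_vdegree_abs\<close>.\<close>

lemma sum_sum_vdegree_abs:
  "(\<Sum>v\<in>{1..k}. vdegree H v * (\<Sum>w\<in>{1..k}. vdegree H w * \<bar>real v - real w\<bar>)) =
    2 * (real k - 1) * (2 * (real k - 1)\<^sup>2 + 1) / 3
    + 2 * ((real i - 1)\<^sup>2 + (real k - real i)\<^sup>2) + 2 * ((real j - 1)\<^sup>2 + (real k - real j)\<^sup>2)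
    + 2 * (real j - real i)"
proof -
  have i: "i \<in> {1..k}" and j: "j \<in> {1..k}" using i1 ij jk by auto
  have "(\<Sum>v\<in>{1..k}. vdegree H v * (\<Sum>w\<in>{1..k}. vdegree H w * \<bar>real v - real w\<bar>)) =
    (\<Sum>v\<in>{1..k}. vdegree H v * ((real v - 1)\<^sup>2 + (real k - real v)\<^sup>2))
    + (\<Sum>v\<in>{1..k}. vdegree H v * \<bar>real i - real v\<bar>) + (\<Sum>v\<in>{1..k}. vdegree H v * \<bar>real j - real v\<bar>)"
    unfolding sum.distrib[symmetric]
    by (intro sum.cong refl)
       (simp only: sum_vdegree_abs distrib_left abs_minus_commute add.assoc)
  also have "\<dots> = 2 * (real k - 1) * (2 * (real k - 1)\<^sup>2 + 1) / 3
    + 2 * ((real i - 1)\<^sup>2 + (real k - real i)\<^sup>2) + 2 * ((real j - 1)\<^sup>2 + (real k - real j)\<^sup>2)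
    + 2 * (real j - real i)"
    unfolding sum_vdegree_abs[OF i] sum_vdegree_abs[OF j]
    unfolding sum_vdegree_H
    using i1 ij jk by (subst edge_sum_squares) auto
  finally show ?thesis .
qed

text \<open>Expanding the squared difference of projections reduces the chord correction to the
  first two degree-weighted moments \<open>S1\<close> and \<open>S2\<close>.\<close>

lemma kemeny_H:
  "kemeny H = (2 * (real k - 1) * (2 * (real k - 1)\<^sup>2 + 1) / 3
    + 2 * ((real i - 1)\<^sup>2 + (real k - real i)\<^sup>2) + 2 * ((real j - 1)\<^sup>2 + (real k - real j)\<^sup>2)
    + 2 * (real j - real i)
    - (4 * real k * ((2 * (real j - real i) ^ 3 + (real j - real i)) / 3 + (real j - real i)\<^sup>2
          + 2 * (real j - real i)\<^sup>2 * (real k - real j))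
       - 2 * ((real j - real i) * (real j - real i + 1 + 2 * (real k - real j)))\<^sup>2)
      / (real j - real i + 1)) / (4 * real k)"
proof -
  interpret resistance_graph H "chord_resistance i j" "chord_tau k i j"
    by (rule resistance_H)
  \<comment> \<open>The shift by \<open>i\<close> leaves differences unchanged and makes the left
    tail contribute nothing to the moments.\<close>
  define q where "q v = cyc_proj i j v - real i" for v
  define c where "c = real j - real i + 1"
  define S1 where "S1 = (\<Sum>v\<in>{1..k}. deg v * q v)"
  define S2 where "S2 = (\<Sum>v\<in>{1..k}. deg v * (q v)\<^sup>2)"
  have vol: "vol = 2 * real k"
    using sum_vdegree_one by (simp add: vol_def)
  have "(\<Sum>v\<in>{1..k}. deg v * (\<Sum>w\<in>{1..k}. deg w * chord_resistance i j v w)) =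
    (\<Sum>v\<in>{1..k}. deg v * (\<Sum>w\<in>{1..k}. deg w * \<bar>real v - real w\<bar>)
      - (deg v * (q v)\<^sup>2 * vol - 2 * S1 * (deg v * q v) + deg v * S2) / c)"
  proof (intro sum.cong refl)
    fix v
    have "(\<Sum>w\<in>{1..k}. deg w * chord_resistance i j v w) =
      (\<Sum>w\<in>{1..k}. deg w * \<bar>real v - real w\<bar>
        - ((q v)\<^sup>2 * deg w - 2 * q v * (deg w * q w) + deg w * (q w)\<^sup>2) / c)"
    proof (intro sum.cong refl)
      fix w
      have "(cyc_proj i j v - cyc_proj i j w)\<^sup>2 = (q v)\<^sup>2 - 2 * q v * q w + (q w)\<^sup>2"
        by (simp add: q_def power2_eq_square algebra_simps)
      then have R: "chord_resistance i j v w =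
          \<bar>real v - real w\<bar> - ((q v)\<^sup>2 - 2 * q v * q w + (q w)\<^sup>2) / c"
        by (simp add: chord_resistance_def c_def)
      show "deg w * chord_resistance i j v w = deg w * \<bar>real v - real w\<bar>
        - ((q v)\<^sup>2 * deg w - 2 * q v * (deg w * q w) + deg w * (q w)\<^sup>2) / c"
        unfolding R by (simp add: algebra_simps add_divide_distrib diff_divide_distrib)
    qed
    also have "\<dots> = (\<Sum>w\<in>{1..k}. deg w * \<bar>real v - real w\<bar>)
        - ((q v)\<^sup>2 * vol - 2 * q v * S1 + S2) / c"
      by (simp add: sum_subtractf sum.distrib sum_divide_distrib[symmetric]
          sum_distrib_left[symmetric] S1_def S2_def vol_def)
    finally have R: "(\<Sum>w\<in>{1..k}. deg w * chord_resistance i j v w) = \<dots>" .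
    show "deg v * (\<Sum>w\<in>{1..k}. deg w * chord_resistance i j v w) =
      deg v * (\<Sum>w\<in>{1..k}. deg w * \<bar>real v - real w\<bar>)
      - (deg v * (q v)\<^sup>2 * vol - 2 * S1 * (deg v * q v) + deg v * S2) / c"
      unfolding R by (simp add: algebra_simps add_divide_distrib diff_divide_distrib)
  qed
  also have "\<dots> = (\<Sum>v\<in>{1..k}. deg v * (\<Sum>w\<in>{1..k}. deg w * \<bar>real v - real w\<bar>))
      - (S2 * vol - 2 * S1 * S1 + vol * S2) / c"
    by (simp add: sum_subtractf sum.distrib sum_divide_distrib[symmetric]
        sum_distrib_left[symmetric] sum_distrib_right[symmetric]
        S1_def S2_def vol_def)
  also have "S2 * vol - 2 * S1 * S1 + vol * S2 = 4 * real k * S2 - 2 * S1\<^sup>2"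
    by (simp add: vol power2_eq_square)
  finally show ?thesis
    unfolding kemeny_eq_resistance_sum vol
    unfolding verts_add_edge verts_path_graph S1_def S2_def q_def sum_sum_vdegree_abs
      sum_vdegree_cyc_proj sum_vdegree_cyc_proj_square c_def by simp
qed

end

section \<open>The polynomial inequality and the conclusion\<close>

text \<open>Here \<open>a\<close> and \<open>b\<close> are the lengths of the two tails and \<open>l + 1\<close> is the length of the cycle.
  In terms of \<open>s = a + b\<close> and \<open>d = a - b\<close> the hypotheses give \<open>d\<^sup>2 \<le> s * l\<close>.\<close>

lemma chord_polynomial_neg:
  fixes a b l :: real
  assumes "a \<ge> 0" "b \<ge> 0" "l \<ge> 2" "\<bar>a - b\<bar> \<le> l"
  defines "k \<equiv> a + b + l + 1"
  shows "2 * (a\<^sup>2 + (b + l)\<^sup>2) + 2 * ((a + l)\<^sup>2 + b\<^sup>2) + 2 * l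
    - (4 * k * ((2 * l ^ 3 + l) / 3 + l\<^sup>2 + 2 * l\<^sup>2 * b) - 2 * (l * (l + 1 + 2 * b))\<^sup>2) / (l + 1)
    < 2 * (2 * (k - 1)\<^sup>2 + 1) / 3" (is "?lhs < ?rhs")
proof -
  define s d where "s = a + b" and "d = a - b"
  have s: "s \<ge> 0" and "\<bar>d\<bar> \<le> s" "\<bar>d\<bar> \<le> l" using assms by (auto simp: s_def d_def)
  then have "\<bar>d\<bar> * \<bar>d\<bar> \<le> s * l" by (intro mult_mono) auto
  then have d: "d\<^sup>2 \<le> s * l" by (simp add: power2_eq_square)
  have l2: "2 * l \<le> l\<^sup>2"
    unfolding power2_eq_square using assms(3) by (intro mult_right_mono) auto
  have "6 * d\<^sup>2 * (l\<^sup>2 + l + 1) \<le> 6 * (s * l) * (l\<^sup>2 + l + 1)"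
    using d assms(3) by (intro mult_right_mono) auto
  also have "\<dots> = 8 * l\<^sup>2 * (l + 1) * s - 2 * (s * l) * (l\<^sup>2 + l - 3)"
    by (simp add: power2_eq_square algebra_simps)
  also have "\<dots> \<le> 8 * l\<^sup>2 * (l + 1) * s"
  proof -
    have "l\<^sup>2 + l - 3 \<ge> 0" using assms(3) l2 by linarith
    then have "2 * (s * l) * (l\<^sup>2 + l - 3) \<ge> 0" using s assms(3) by simp
    then show ?thesis by linarith
  qed
  \<comment> \<open>The term in \<open>d\<^sup>2\<close> is the only positive one in the expansion
    below; here it is absorbed.\<close>
  finally have main: "6 * d\<^sup>2 * (l\<^sup>2 + l + 1) \<le> 8 * l\<^sup>2 * (l + 1) * s" .
  have sq: "s\<^sup>2 * (6 * l\<^sup>2 - 2 * l - 2) \<ge> 0"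
    using assms(3) l2 by (intro mult_nonneg_nonneg zero_le_power2) linarith
  have "l\<^sup>2 - 1 > 0" using assms(3) l2 by linarith
  then have last: "2 * (l\<^sup>2 - 1)\<^sup>2 > 0" by simp
  have "3 * (l + 1) * (?lhs - ?rhs) = - (s\<^sup>2 * (6 * l\<^sup>2 - 2 * l - 2))
      + 6 * d\<^sup>2 * (l\<^sup>2 + l + 1) - 8 * l\<^sup>2 * (l + 1) * s - 2 * (l\<^sup>2 - 1)\<^sup>2"
  proof -
    \<comment> \<open>Isolating the only division leaves a polynomial identity.\<close>
    have cancel: "3 * (l + 1) * (x - y / (l + 1) - z) = 3 * (l + 1) * (x - z) - 3 * y" for x y z
      using assms(3) by (simp add: field_simps)
    show ?thesis
      unfolding cancel k_def s_def d_def
      by (simp add: power2_eq_square power3_eq_cube field_simps)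
  qed
  also have "\<dots> < 0" using main sq last by linarith
  finally show ?thesis using assms(3) by (simp add: mult_less_0_iff)
qed

theorem theorem3p2:
  fixes k i j :: nat
  assumes "k \<ge> 3"
    and "1 \<le> i" and "i < j" and "j \<le> k"
    and "j - i \<ge> 2"
    and "int i \<le> \<lceil>real k / 2\<rceil>" and "\<lceil>real k / 2\<rceil> < int j"
  shows "kemeny (add_edge (path_graph k) i j) - kemeny (path_graph k) < 0"
proof -
  interpret chorded_path k i j
    using assms by unfold_locales auto
  define a b l where "a = real i - 1" and "b = real k - real j" and "l = real j - real i"
  have "real_of_int (int i) < real k / 2 + 1" "real k / 2 < real_of_int (int j)"
    using assms(6,7) by linarith+
  \<comment> \<open>Integrality sharpens the strict bounds. Together the two inequalities say
    exactly that \<open>\<bar>a - b\<bar> \<le> l\<close>.\<close>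
  then have "2 * i \<le> k + 1" "k + 1 \<le> 2 * j" by linarith+
  then have "2 * real i \<le> real k + 1" "real k + 1 \<le> 2 * real j" by linarith+
  then have abl: "a \<ge> 0" "b \<ge> 0" "l \<ge> 2" "\<bar>a - b\<bar> \<le> l"
    using assms(2-5) by (auto simp: a_def b_def l_def abs_if)
  have k: "real k = a + b + l + 1" by (simp add: a_def b_def l_def)
  have ik: "real k - real i = b + l" "real j - 1 = a + l" by (simp_all add: a_def b_def l_def)
  define X where "X = 2 * (a\<^sup>2 + (b + l)\<^sup>2) + 2 * ((a + l)\<^sup>2 + b\<^sup>2) + 2 * l
    - (4 * real k * ((2 * l ^ 3 + l) / 3 + l\<^sup>2 + 2 * l\<^sup>2 * b) - 2 * (l * (l + 1 + 2 * b))\<^sup>2) / (l + 1)"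
  define Y where "Y = 2 * (2 * (real k - 1)\<^sup>2 + 1) / 3"
  have "X < Y"
    unfolding X_def Y_def k by (rule chord_polynomial_neg[OF abl])
  \<comment> \<open>Up to the factor 4 this is a weighted mean of \<open>Y\<close> and
    \<open>X\<close>, with weights \<open>k - 1\<close> and 1, while the path gives \<open>Y\<close>
    alone; so \<open>X < Y\<close> suffices.\<close>
  moreover have "kemeny H = ((real k - 1) * Y + X) / (4 * real k)"
    unfolding kemeny_H X_def Y_def ik a_def[symmetric] b_def[symmetric] l_def[symmetric]
    by (simp add: algebra_simps)
  moreover have "kemeny (path_graph k) = Y / 4"
    using assms(1) by (simp add: kemeny_path_graph Y_def)
  moreover have "((real k - 1) * Y + X) / (4 * real k) < Y / 4"
    using \<open>X < Y\<close> assms(1) by (simp add: field_simps)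
  ultimately show ?thesis by linarith
qed

end
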